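(* Let $(X,Y,Z)$ be a real-valued centered Gaussian random vector (jointly Gaussian with mean zero) in $\mathbb{R}^3$ such that each of $X,Y,Z$ has positive variance. Then for all $m,n\in\mathbb{N}$, $$\mathbf{E}\left[X^{2m}Y^{2m}Z^{2n}\right]\geq \mathbf{E}[X^{2m}]\,\mathbf{E}[Y^{2m}]\,\mathbf{E}[Z^{2n}].$$
   Context: $\mathbb{N}=\{1,2,3,\dots\}$. $\mathbf{E}$ denotes expectation. The covariance matrix of $(X,Y,Z)$ is allowed to be singular; only the individual components are required to be non-degenerate (positive variance). *)

theory Defs
  imports "HOL-Probability.Probability"
begin

(* Point masses count as Gaussian (variance zero). normal_density is a probability
   density only for \<sigma> > 0, so they need a case of their own. *)
definition gaussian_rv :: "'w measure \<Rightarrow> ('w \<Rightarrow> real) \<Rightarrow> bool" where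
  "gaussian_rv M X \<longleftrightarrow> X \<in> borel_measurable M \<and>
     ((\<exists>\<mu> \<sigma>. 0 < \<sigma> \<and> distributed M lborel X (normal_density \<mu> \<sigma>)) \<or>
      (\<exists>\<mu>. AE \<omega> in M. X \<omega> = \<mu>))"

(* Joint Gaussianity: every linear functional of the vector is Gaussian. This
   admits singular covariance matrices. *)
definition gaussian_vector :: "'w measure \<Rightarrow> ('w \<Rightarrow> 'a::euclidean_space) \<Rightarrow> bool" where
  "gaussian_vector M V \<longleftrightarrow> V \<in> borel_measurable M \<and>
     (\<forall>a. gaussian_rv M (\<lambda>\<omega>. a \<bullet> V \<omega>))"

(* The components of a Gaussian vector are integrable, so the Bochner integral below
   is its actual mean, never the default value 0 of a non-integrable function. *)
definition centered_gaussian_vector :: "'w measure \<Rightarrow> ('w \<Rightarrow> 'a::euclidean_space) \<Rightarrow> bool" where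
  "centered_gaussian_vector M V \<longleftrightarrow> gaussian_vector M V \<and> prob_space.expectation M V = 0"

end

theory Submission
  imports Defs
begin

text \<open>
  Normalise X and Y and put U = (X + Y)/2, V = (X - Y)/2. Equality of the two exponents
  enters here: X Y = U^2 - V^2, and U, V are uncorrelated with variances summing to 1.
  Write Z = p U + q V + W with W uncorrelated with U and V. Expanding the power of Z, only
  monomials with even exponents contribute, and their coefficients are nonnegative, so Z may be
  replaced by a single monomial in U, V, W.

  The weighted moments of U^2 and V^2 are rising factorials, so with x = E U^2
  the expectation to be bounded is, up to known factors, the coefficient L of w^(2m) in
  (1 - x w)^(-a) (1 - (x - 1) w)^(-b), where a, b are at least 1/2 and x lies in [0, 1].
  At a minimum over x, the coefficient of w^(2m - 1) vanishes, and this turns 2m (a + b) L into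
  a b times the coefficient of w^(2m - 2) for the parameters a + 1, b + 1. Since
  a b/(a + b) increases in a and b, induction on m reduces the bound to a = b = 1/2, x = 1/2, that
  is, to independent X and Y, where equality holds.
\<close>

section \<open>Generating functions of rising factorials\<close>

(* The expansion of (1 - x * w) powr (- a) in powers of w. *)
definition rising_fps :: "real \<Rightarrow> real \<Rightarrow> real fps" where
  "rising_fps a x = Abs_fps (\<lambda>k. pochhammer a k * x ^ k / fact k)"

text \<open>Holds because \<open>pochhammer\<close> has a recursion at either end. It brings all
  series to the parameters \<open>a + 1\<close> and \<open>b + 1\<close>, so that the identities
  below become polynomial multiples of one common series.\<close>

lemma rising_fps_shift:
  "rising_fps a x = (1 - fps_const x * fps_X) * rising_fps (a + 1) x"
proof (rule fps_ext)
  fix n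
  show "fps_nth (rising_fps a x) n = fps_nth ((1 - fps_const x * fps_X) * rising_fps (a + 1) x) n"
  proof (cases n)
    case 0
    then show ?thesis by (simp add: rising_fps_def)
  next
    case (Suc k)
    have "pochhammer a (Suc k) = a * pochhammer (a + 1) k"
      "pochhammer (a + 1) (Suc k) = pochhammer (a + 1) k * (a + 1 + real k)"
      by (simp_all only: pochhammer_rec[of a] pochhammer_Suc[of "a + 1"])
    then show ?thesis
      unfolding Suc left_diff_distrib mult.assoc
      by (simp add: rising_fps_def divide_simps add_eq_0_iff) (simp add: algebra_simps)
  qed
qed

lemma fps_deriv_rising_fps:
  "fps_deriv (rising_fps a x) = fps_const (a * x) * rising_fps (a + 1) x"
  by (rule fps_ext) (simp add: rising_fps_def pochhammer_rec field_simps del: of_nat_Suc)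

text \<open>This is d/dx (1 - x w)^(-a) = a w (1 - x w)^(-a-1), read one coefficient at a time,
  since x is a real parameter of a formal series in w.\<close>

lemma DERIV_rising_fps_nth:
  "((\<lambda>x. fps_nth (rising_fps a x) n) has_field_derivative
     fps_nth (fps_const a * fps_X * rising_fps (a + 1) x) n) (at x)"
proof (cases n)
  case 0
  then show ?thesis by (simp add: rising_fps_def)
next
  case (Suc k)
  have "((\<lambda>x. pochhammer a (Suc k) * x ^ Suc k / fact (Suc k)) has_field_derivative
     pochhammer a (Suc k) * (real (Suc k) * x ^ k) / fact (Suc k)) (at x)"
    by (rule derivative_eq_intros refl | simp del: power_Suc of_nat_Suc fact_Suc)+
  moreover have "pochhammer a (Suc k) * (real (Suc k) * x ^ k) / fact (Suc k)
     = a * (pochhammer (a + 1) k * x ^ k / fact k)"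
    by (simp add: pochhammer_rec del: of_nat_Suc)
  ultimately show ?thesis unfolding Suc mult.assoc
    by (simp add: rising_fps_def del: fact_Suc)
qed

text \<open>The argument \<open>x - 1\<close> absorbs the sign in U^2 - V^2: for x = E U^2 it equals
  - E V^2.\<close>

definition rising_coeff :: "real \<Rightarrow> real \<Rightarrow> nat \<Rightarrow> real \<Rightarrow> real" where
  "rising_coeff a b n x = fps_nth (rising_fps a x * rising_fps b (x - 1)) n"

lemma DERIV_rising_coeff:
  "((\<lambda>x. rising_coeff a b n x) has_field_derivative
     fps_nth (fps_X * (fps_const a * rising_fps (a + 1) x * rising_fps b (x - 1)
        + fps_const b * rising_fps a x * rising_fps (b + 1) (x - 1))) n) (at x)"
proof -
  define P where "P = fps_const a * fps_X * rising_fps (a + 1) x"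
  define Q where "Q = fps_const b * fps_X * rising_fps (b + 1) (x - 1)"
  have a: "((\<lambda>x. fps_nth (rising_fps a x) k) has_field_derivative fps_nth P k) (at x)" for k
    unfolding P_def by (rule DERIV_rising_fps_nth)
  have b: "((\<lambda>x. fps_nth (rising_fps b (x - 1)) k) has_field_derivative fps_nth Q k) (at x)" for k
    using DERIV_shift[of "\<lambda>x. fps_nth (rising_fps b x) k" "fps_nth Q k" x "- 1"]
      DERIV_rising_fps_nth[of b k "x - 1"]
    by (simp add: Q_def)
  have eq: "fps_X * (fps_const a * rising_fps (a + 1) x * rising_fps b (x - 1)
        + fps_const b * rising_fps a x * rising_fps (b + 1) (x - 1))
     = P * rising_fps b (x - 1) + rising_fps a x * Q"
    by (simp add: P_def Q_def algebra_simps)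
  show ?thesis
    unfolding eq rising_coeff_def fps_add_nth fps_mult_nth sum.distrib[symmetric]
    by (auto intro!: DERIV_sum derivative_eq_intros a b)
qed

lemma rising_coeff_0 [simp]: "rising_coeff a b 0 x = 1"
  by (simp add: rising_coeff_def rising_fps_def)

lemma rising_coeff_at_0: "rising_coeff a b n 0 = pochhammer b n * (- 1) ^ n / fact n"
proof -
  have "rising_fps a 0 = 1"
    by (rule fps_ext) (simp add: rising_fps_def power_0_left)
  then show ?thesis by (simp add: rising_coeff_def rising_fps_def)
qed

lemma rising_coeff_at_1: "rising_coeff a b n 1 = pochhammer a n / fact n"
proof -
  have "rising_fps b 0 = 1"
    by (rule fps_ext) (simp add: rising_fps_def power_0_left)
  then show ?thesis by (simp add: rising_coeff_def rising_fps_def)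
qed

section \<open>Recurrences through the common series \<open>R\<close>\<close>

context
  fixes a b x :: real and R :: "real fps"
  defines "R \<equiv> rising_fps (a + 1) x * rising_fps (b + 1) (x - 1)"
begin

text \<open>The two linear factors split off by \<open>rising_fps_shift\<close> multiply to 1 - (2x
  - 1) w + x (x - 1) w^2.\<close>

lemma rising_coeff_shift:
  "rising_coeff a b n x =
     fps_nth (R - fps_const (2 * x - 1) * (fps_X * R) + fps_const (x * (x - 1)) * (fps_X * (fps_X * R))) n"
  unfolding rising_coeff_def R_def
  by (subst rising_fps_shift[of a], subst rising_fps_shift[of b])
    (simp add: algebra_simps fps_const_add[symmetric] fps_const_sub[symmetric] fps_const_mult[symmetric]
      numeral_fps_const[symmetric] del: fps_const_add fps_const_sub fps_const_mult)

text \<open>Both sides are coefficient \<open>n\<close> of the derivative in w. The product rule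
  leaves a x (1 - (x - 1) w) + b (x - 1) (1 - x w) in front of \<open>R\<close>.\<close>

lemma rising_coeff_euler:
  "real (Suc n) * rising_coeff a b (Suc n) x =
     fps_nth (fps_const (a * x + b * (x - 1)) * R - fps_const ((a + b) * x * (x - 1)) * (fps_X * R)) n"
proof -
  have "real (Suc n) * rising_coeff a b (Suc n) x
      = fps_nth (fps_deriv (rising_fps a x * rising_fps b (x - 1))) n"
    by (simp add: rising_coeff_def del: fps_deriv_mult)
  also have "fps_deriv (rising_fps a x * rising_fps b (x - 1)) =
     fps_const (a * x + b * (x - 1)) * R - fps_const ((a + b) * x * (x - 1)) * (fps_X * R)"
    unfolding fps_deriv_mult fps_deriv_rising_fps R_def
    by (subst rising_fps_shift[of a], subst rising_fps_shift[of b])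
      (simp add: algebra_simps fps_const_add[symmetric] fps_const_sub[symmetric] fps_const_mult[symmetric]
       del: fps_const_add fps_const_sub fps_const_mult)
  finally show ?thesis .
qed

text \<open>The generating function L satisfies dL/dx = w ((a + b) L + w dL/dw), by the two
  preceding identities. The outer w shifts the index by one and w d/dw contributes \<open>n\<close>.
  Hence critical points of a coefficient are zeros of its predecessor.\<close>

lemma DERIV_rising_coeff_Suc:
  "((\<lambda>x. rising_coeff a b (Suc n) x) has_field_derivative
     (a + b + real n) * rising_coeff a b n x) (at x)"
proof -
  have eq: "fps_const a * rising_fps (a + 1) x * rising_fps b (x - 1)
        + fps_const b * rising_fps a x * rising_fps (b + 1) (x - 1) =
      fps_const (a + b) * R - fps_const (a * (x - 1) + b * x) * (fps_X * R)"
    unfolding R_def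
    by (subst rising_fps_shift[of a], subst rising_fps_shift[of b])
      (simp add: algebra_simps fps_const_add[symmetric] fps_const_sub[symmetric] fps_const_mult[symmetric]
       del: fps_const_add fps_const_sub fps_const_mult)
  have "fps_nth (fps_const (a + b) * R - fps_const (a * (x - 1) + b * x) * (fps_X * R)) n
      = (a + b) * rising_coeff a b n x + real n * rising_coeff a b n x"
  proof (cases n)
    case 0
    then show ?thesis by (simp add: R_def rising_fps_def)
  next
    case (Suc k)
    show ?thesis
      unfolding Suc rising_coeff_euler
      unfolding rising_coeff_shift
      by (simp del: of_nat_Suc) (simp add: algebra_simps)
  qed
  then show ?thesis
    using DERIV_rising_coeff[of a b "Suc n" x] unfolding eq
    by (simp add: algebra_simps)
qed

(* The hypothesis says that x is a critical point of the coefficient of index n + 2. *)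
lemma rising_coeff_critical:
  assumes "rising_coeff a b (Suc n) x = 0"
  shows "(a + b) * (real (Suc (Suc n)) * rising_coeff a b (Suc (Suc n)) x)
     = a * b * rising_coeff (a + 1) (b + 1) n x"
proof -
  define e where "e = (\<lambda>k. fps_nth R k)"
  \<comment> \<open>The coefficient of \<open>R\<close> of index n - 1, read as 0 for
    \<open>n = 0\<close>; this form saves a case distinction.\<close>
  define d where "d = fps_nth (fps_X * R) n"
  have 1: "e (Suc n) - (2 * x - 1) * e n + x * (x - 1) * d = 0"
    using assms unfolding rising_coeff_shift by (simp add: e_def d_def)
  have 2: "(a * x + b * (x - 1)) * e n - (a + b) * x * (x - 1) * d = 0"
    using rising_coeff_euler[of n] assms by (simp add: e_def d_def)
  have 3: "real (Suc (Suc n)) * rising_coeff a b (Suc (Suc n)) x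
      = (a * x + b * (x - 1)) * e (Suc n) - (a + b) * x * (x - 1) * e n"
    unfolding rising_coeff_euler by (simp add: e_def)
  have "rising_coeff (a + 1) (b + 1) n x = e n"
    by (simp add: rising_coeff_def R_def e_def)
  \<comment> \<open>Eliminating \<open>d\<close> from the first two equations gives (a + b) e(n+1) =
    ((a + b) x - a) e(n). After substitution all terms in x cancel and a b remains.\<close>
  moreover have "(a + b) * ((a * x + b * (x - 1)) * e (Suc n) - (a + b) * x * (x - 1) * e n)
      = a * b * e n" using 1 2 by algebra
  ultimately show ?thesis by (simp only: 3)
qed

end

text \<open>The bound is the exact value at a = b = h, x = 1/2, where the series is (1 -
  w^2/4)^(-h). The number \<open>h\<close> is kept free because the induction step raises
  \<open>a\<close>, \<open>b\<close> and \<open>h\<close> by one together.\<close>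

lemma rising_coeff_lower_bound:
  assumes "0 < h" "h \<le> a" "h \<le> b" "0 \<le> x" "x \<le> 1"
  shows "pochhammer h m / (4 ^ m * fact m) \<le> rising_coeff a b (2 * m) x"
  using assms
proof (induction m arbitrary: h a b x)
  case 0
  then show ?case by simp
next
  case (Suc m)
  let ?F = "rising_coeff a b (2 * Suc m)" and ?G = "rising_coeff a b (Suc (2 * m))"
  define c where "c = a + b + real (Suc (2 * m))"
  have ab: "0 < a" "0 < b" using Suc.prems by auto
  have c: "0 < c" using ab by (simp add: c_def)
  have D: "(?F has_field_derivative c * ?G y) (at y)" for y
    using DERIV_rising_coeff_Suc[of a b "Suc (2 * m)" y] by (simp add: c_def)
  have "continuous_on {0..1} ?F"
    using D by (intro continuous_at_imp_continuous_on ballI DERIV_isCont)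
  then obtain z where z: "0 \<le> z" "z \<le> 1" and min: "\<And>y. 0 \<le> y \<Longrightarrow> y \<le> 1 \<Longrightarrow> ?F z \<le> ?F y"
    using continuous_attains_inf[of "{0..1::real}" ?F] by auto
  \<comment> \<open>At 0 the derivative is \<open>c\<close> times an odd coefficient of (1 +
    w)^(-b), hence negative, so smaller values lie just inside the interval. At 1 it is positive,
    with the same consequence. The minimum is therefore interior and critical.\<close>
  have "z \<noteq> 0"
  proof
    assume z0: "z = 0"
    have "?G 0 < 0" using ab by (simp add: rising_coeff_at_0 pochhammer_pos del: fact_Suc)
    then have "c * ?G z < 0" unfolding z0 by (rule mult_pos_neg[OF c])
    from DERIV_neg_dec_right[OF D this] obtain d where d: "d > 0"
      "\<And>k. k > 0 \<Longrightarrow> k < d \<Longrightarrow> ?F (z + k) < ?F z" by auto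
    have "0 < min (d / 2) 1" "min (d / 2) 1 < d" "min (d / 2) 1 \<le> 1"
      using d(1) by (auto simp: min_def)
    with d(2)[of "min (d / 2) 1"] min[of "z + min (d / 2) 1"] show False
      unfolding z0 by linarith
  qed
  moreover have "z \<noteq> 1"
  proof
    assume z1: "z = 1"
    have "?G 1 > 0" using ab by (simp add: rising_coeff_at_1 pochhammer_pos del: fact_Suc)
    then have "c * ?G z > 0" unfolding z1 by (rule mult_pos_pos[OF c])
    from DERIV_pos_inc_left[OF D this] obtain d where d: "d > 0"
      "\<And>k. k > 0 \<Longrightarrow> k < d \<Longrightarrow> ?F (z - k) < ?F z" by auto
    have "0 < min (d / 2) 1" "min (d / 2) 1 < d" "min (d / 2) 1 \<le> 1"
      using d(1) by (auto simp: min_def)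
    with d(2)[of "min (d / 2) 1"] min[of "z - min (d / 2) 1"] show False
      unfolding z1 by linarith
  qed
  ultimately have z': "0 < z" "z < 1" using z by auto
  have "c * ?G z = 0"
  proof (rule DERIV_local_min[OF D, of "min z (1 - z)"])
    show "0 < min z (1 - z)" using z' by simp
    show "\<forall>y. \<bar>z - y\<bar> < min z (1 - z) \<longrightarrow> ?F z \<le> ?F y"
      using min by (auto simp: abs_less_iff)
  qed
  then have "?G z = 0" using c by simp
  from rising_coeff_critical[OF this]
  have "(a + b) * (2 * real (Suc m) * ?F z) = a * b * rising_coeff (a + 1) (b + 1) (2 * m) z"
    by simp
  then have eq: "?F z = a * b / (a + b) * rising_coeff (a + 1) (b + 1) (2 * m) z / (2 * real (Suc m))"
    using ab by (simp add: nonzero_eq_divide_eq mult_ac del: of_nat_Suc)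
  \<comment> \<open>The harmonic mean 2 a b / (a + b) of two numbers that are at least
    \<open>h\<close> is itself at least \<open>h\<close>.\<close>
  have "h * (a + b) \<le> 2 * (a * b)"
    using add_mono[OF mult_right_mono[of h b a] mult_right_mono[of h a b]] Suc.prems ab
    by (simp add: algebra_simps)
  then have hab: "h / 2 \<le> a * b / (a + b)"
    using ab by (simp add: field_simps)
  have IH: "pochhammer (h + 1) m / (4 ^ m * fact m) \<le> rising_coeff (a + 1) (b + 1) (2 * m) z"
    using Suc.IH[of "h + 1" "a + 1" "b + 1" z] Suc.prems z by simp
  have "pochhammer h (Suc m) / (4 ^ Suc m * fact (Suc m))
      = h / 2 * (pochhammer (h + 1) m / (4 ^ m * fact m)) / (2 * real (Suc m))"
    by (simp add: pochhammer_rec field_simps)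
  also have "\<dots> \<le> ?F z"
    unfolding eq using Suc.prems ab
    by (intro divide_right_mono mult_mono hab IH divide_nonneg_pos mult_nonneg_nonneg)
      (auto intro!: pochhammer_nonneg)
  also have "\<dots> \<le> ?F x" using min Suc.prems by simp
  finally show ?case .
qed

section \<open>Moments of a centered Gaussian variable\<close>

text \<open>The moments of the standard normal law: 1 * 3 * ... * (n - 1) for even \<open>n\<close>,
  written as a rising factorial to match the coefficients above.\<close>

definition gauss_moment :: "nat \<Rightarrow> real" where
  "gauss_moment n = (if even n then 2 ^ (n div 2) * pochhammer (1 / 2) (n div 2) else 0)"

lemma gauss_moment_even: "gauss_moment (2 * k) = 2 ^ k * pochhammer (1 / 2) k"
  by (simp add: gauss_moment_def)

lemma gauss_moment_odd: "odd n \<Longrightarrow> gauss_moment n = 0"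
  by (simp add: gauss_moment_def)

lemma gauss_moment_nonneg: "0 \<le> gauss_moment n"
  by (simp add: gauss_moment_def pochhammer_nonneg)

lemma gauss_moment_fact: "gauss_moment (2 * k) = fact (2 * k) / (2 ^ k * fact k)"
  by (simp add: gauss_moment_even fact_double power_mult power_mult_distrib[symmetric])
    (simp add: field_simps power_mult_distrib[symmetric])

text \<open>Source of the parameters \<open>1 / 2 + real i\<close>: weighting by the power 2i of a
  Gaussian variable shifts the start of the rising factorial by i.\<close>

lemma gauss_moment_add:
  "gauss_moment (2 * (i + k)) = gauss_moment (2 * i) * (2 ^ k * pochhammer (1 / 2 + real i) k)"
  unfolding gauss_moment_even by (simp add: pochhammer_product' power_add)

lemma sum_even_indices:
  fixes f :: "nat \<Rightarrow> real"
  assumes "\<And>k. odd k \<Longrightarrow> f k = 0"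
  shows "(\<Sum>k\<le>2 * n. f k) = (\<Sum>l\<le>n. f (2 * l))"
  by (induction n) (simp_all add: assms)

text \<open>The moment form of the fact that variances of independent centered Gaussians add, proved
  without any measure. Odd terms vanish, and the identity \<open>c\<close> below turns the even ones
  into the binomial expansion of (x^2 + y^2)^n.\<close>

lemma gauss_moment_binomial:
  assumes "r\<^sup>2 = x\<^sup>2 + y\<^sup>2"
  shows "gauss_moment N * r ^ N =
    (\<Sum>k\<le>N. real (N choose k) * (gauss_moment k * x ^ k) * (gauss_moment (N - k) * y ^ (N - k)))"
proof (cases "even N")
  case False
  then have "gauss_moment k * gauss_moment (N - k) = 0" if "k \<le> N" for k
    using that by (auto simp: gauss_moment_def)
  then have "(\<Sum>k\<le>N. real (N choose k) * (gauss_moment k * x ^ k) *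
      (gauss_moment (N - k) * y ^ (N - k))) = 0"
    by (intro sum.neutral) auto
  then show ?thesis using False by (simp add: gauss_moment_odd)
next
  case True
  then obtain n where N: "N = 2 * n" by (elim evenE)
  have c: "real (2 * n choose 2 * l) * gauss_moment (2 * l) * gauss_moment (2 * (n - l))
      = gauss_moment (2 * n) * real (n choose l)" if "l \<le> n" for l
  proof -
    have "(2::real) ^ n = 2 ^ l * 2 ^ (n - l)" using that by (simp flip: power_add)
    then show ?thesis
      using that unfolding gauss_moment_fact
      by (simp add: binomial_fact diff_mult_distrib2 diff_mult_distrib field_simps)
  qed
  have "gauss_moment N * r ^ N = gauss_moment (2 * n) * (x\<^sup>2 + y\<^sup>2) ^ n"
    by (simp add: N power_mult assms)
  also have "\<dots> = (\<Sum>l\<le>n. gauss_moment (2 * n) * real (n choose l) * (x ^ (2 * l) * y ^ (2 * (n - l))))"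
    unfolding power_mult[of _ 2] by (simp add: binomial_ring sum_distrib_left mult_ac)
  also have "\<dots> = (\<Sum>l\<le>n. real (N choose (2 * l)) * (gauss_moment (2 * l) * x ^ (2 * l)) *
      (gauss_moment (N - 2 * l) * y ^ (N - 2 * l)))"
    by (rule sum.cong) (simp_all add: c[symmetric] N diff_mult_distrib2)
  also have "\<dots> = (\<Sum>k\<le>N. real (N choose k) * (gauss_moment k * x ^ k) *
      (gauss_moment (N - k) * y ^ (N - k)))"
    unfolding N by (subst sum_even_indices) (simp_all add: gauss_moment_odd)
  finally show ?thesis .
qed

text \<open>Only moments are recorded, not the law. The value \<open>\<sigma> = 0\<close> covers the
  point mass at 0, with 0 ^ 0 = 1 giving total mass one.\<close>

definition has_gauss_moments :: "'w measure \<Rightarrow> ('w \<Rightarrow> real) \<Rightarrow> real \<Rightarrow> bool" where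
  "has_gauss_moments M T \<sigma> \<longleftrightarrow> T \<in> borel_measurable M \<and>
     (\<forall>n. has_bochner_integral M (\<lambda>\<omega>. T \<omega> ^ n) (gauss_moment n * \<sigma> ^ n))"

lemma
  assumes "has_gauss_moments M T \<sigma>"
  shows has_gauss_moments_measurable: "T \<in> borel_measurable M"
    and has_gauss_moments_integrable: "integrable M (\<lambda>\<omega>. T \<omega> ^ n)"
    and has_gauss_moments_integral: "(\<integral>\<omega>. T \<omega> ^ n \<partial>M) = gauss_moment n * \<sigma> ^ n"
  using assms by (auto simp: has_gauss_moments_def has_bochner_integral_iff)

text \<open>Taking the scale from the second moment gives one formula for both cases of
  \<open>gaussian_rv\<close>; centering forces the point mass to sit at 0.\<close>

lemma has_gauss_moments_centered:
  assumes "prob_space M" and T: "gaussian_rv M T" and "prob_space.expectation M T = 0"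
  shows "has_gauss_moments M T (sqrt (\<integral>\<omega>. (T \<omega>)\<^sup>2 \<partial>M))"
proof -
  interpret prob_space M by fact
  have [measurable]: "T \<in> borel_measurable M" using T by (simp add: gaussian_rv_def)
  have "\<exists>\<sigma>\<ge>0. has_gauss_moments M T \<sigma>"
    using T unfolding gaussian_rv_def
  proof (elim conjE disjE exE)
    fix \<mu> \<sigma> :: real assume \<sigma>: "0 < \<sigma>" and D: "distributed M lborel T (normal_density \<mu> \<sigma>)"
    then have [simp]: "\<mu> = 0" using normal_distributed_expectation[OF \<sigma> D] assms(3) by simp
    have "has_bochner_integral lborel (\<lambda>x. normal_density 0 \<sigma> x * x ^ n) (gauss_moment n * \<sigma> ^ n)" for n
    proof (cases "even n")
      case True
      then obtain k where n: "n = 2 * k" by (elim evenE)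
      show ?thesis using normal_moment_even[OF \<sigma>, of 0 k] \<sigma>
        by (simp add: n gauss_moment_fact power_divide power_mult)
    next
      case False
      then obtain k where n: "n = 2 * k + 1" by (elim oddE)
      show ?thesis using normal_moment_odd[OF \<sigma>, of 0 k]
        by (simp add: n gauss_moment_odd)
    qed
    then have "has_gauss_moments M T \<sigma>"
      unfolding has_gauss_moments_def has_bochner_integral_iff
      using distributed_integral[OF D] distributed_integrable[OF D] by simp
    then show ?thesis using \<sigma> by (intro exI[of _ \<sigma>]) simp
  next
    fix \<mu> assume ae: "AE \<omega> in M. T \<omega> = \<mu>"
    then have "expectation T = expectation (\<lambda>_. \<mu>)" by (intro integral_cong_AE) auto
    then have "\<mu> = 0" using assms(3) by (simp add: prob_space)
    have "has_bochner_integral M (\<lambda>\<omega>. T \<omega> ^ n) (gauss_moment n * 0 ^ n)" for n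
    proof -
      have "has_bochner_integral M (\<lambda>\<omega>. 0 ^ n :: real) (gauss_moment n * 0 ^ n)"
        by (cases "n = 0") (auto simp: gauss_moment_def has_bochner_integral_iff prob_space)
      moreover have "AE \<omega> in M. 0 ^ n = T \<omega> ^ n" using ae by eventually_elim (simp add: \<open>\<mu> = 0\<close>)
      ultimately show ?thesis
        by (subst (asm) has_bochner_integral_cong_AE) auto
    qed
    then have "has_gauss_moments M T 0" by (simp add: has_gauss_moments_def)
    then show ?thesis by blast
  qed
  then obtain \<sigma> where "\<sigma> \<ge> 0" "has_gauss_moments M T \<sigma>" by blast
  moreover from this have "(\<integral>\<omega>. (T \<omega>)\<^sup>2 \<partial>M) = \<sigma>\<^sup>2"
    by (simp add: has_gauss_moments_integral gauss_moment_def)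
  ultimately show ?thesis by simp
qed

section \<open>Mixed moments of uncorrelated Gaussian variables\<close>

lemma integrable_mult_square_integrable:
  fixes f g :: "'w \<Rightarrow> real"
  assumes [measurable]: "f \<in> borel_measurable M" "g \<in> borel_measurable M"
    and "integrable M (\<lambda>\<omega>. (f \<omega>)\<^sup>2)" "integrable M (\<lambda>\<omega>. (g \<omega>)\<^sup>2)"
  shows "integrable M (\<lambda>\<omega>. f \<omega> * g \<omega>)"
proof (rule Bochner_Integration.integrable_bound)
  show "integrable M (\<lambda>\<omega>. (f \<omega>)\<^sup>2 + (g \<omega>)\<^sup>2)" using assms by simp
  have "\<bar>x * y\<bar> \<le> x\<^sup>2 + y\<^sup>2" for x y :: real
    using sum_squares_bound[of "\<bar>x\<bar>" "\<bar>y\<bar>"] mult_nonneg_nonneg[of "\<bar>x\<bar>" "\<bar>y\<bar>"]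
    unfolding abs_mult power2_abs by linarith
  then show "AE \<omega> in M. norm (f \<omega> * g \<omega>) \<le> norm ((f \<omega>)\<^sup>2 + (g \<omega>)\<^sup>2)" by simp
qed simp

text \<open>Both sides of the second hypothesis are polynomials in t that agree for all real t, so
  their coefficients agree. The factor \<open>g\<close> permits splitting off one variable at a
  time.\<close>

lemma integral_polynomial_coeff:
  fixes g S T :: "'w \<Rightarrow> real"
  assumes "\<And>k. k \<le> N \<Longrightarrow> integrable M (\<lambda>\<omega>. g \<omega> * (S \<omega> ^ k * T \<omega> ^ (N - k)))"
    and "\<And>t. (\<integral>\<omega>. g \<omega> * (t * S \<omega> + T \<omega>) ^ N \<partial>M) = (\<Sum>k\<le>N. real (N choose k) * d k * t ^ k)"
    and "k \<le> N"
  shows "(\<integral>\<omega>. g \<omega> * (S \<omega> ^ k * T \<omega> ^ (N - k)) \<partial>M) = d k"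
proof -
  let ?I = "\<lambda>k. \<integral>\<omega>. g \<omega> * (S \<omega> ^ k * T \<omega> ^ (N - k)) \<partial>M"
  have "(\<Sum>k\<le>N. (real (N choose k) * ?I k) * t ^ k) = (\<Sum>k\<le>N. (real (N choose k) * d k) * t ^ k)" for t
  proof -
    have "(\<integral>\<omega>. g \<omega> * (t * S \<omega> + T \<omega>) ^ N \<partial>M) =
       (\<integral>\<omega>. (\<Sum>k\<le>N. (real (N choose k) * t ^ k) * (g \<omega> * (S \<omega> ^ k * T \<omega> ^ (N - k)))) \<partial>M)"
      by (simp add: binomial_ring sum_distrib_left power_mult_distrib mult_ac)
    also have "\<dots> = (\<Sum>k\<le>N. (real (N choose k) * t ^ k) * ?I k)"
      using assms(1) by (subst Bochner_Integration.integral_sum) auto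
    finally show ?thesis using assms(2) by (simp add: mult_ac)
  qed
  then have "real (N choose k) * ?I k = real (N choose k) * d k"
    using polyfun_eq_coeffs[of "\<lambda>k. real (N choose k) * ?I k" N "\<lambda>k. real (N choose k) * d k"]
      \<open>k \<le> N\<close> by blast
  then show ?thesis using \<open>k \<le> N\<close> by simp
qed

text \<open>Stands in for independence: all linear combinations have the moments they would have for
  independent centered Gaussians of scales \<open>u\<close>, \<open>v\<close>, \<open>w\<close>.
  Scales may be zero, so singular covariance is covered.\<close>

locale uncorrelated_gauss =
  fixes M :: "'w measure" and U V W :: "'w \<Rightarrow> real" and u v w :: real
  assumes lin: "has_gauss_moments M (\<lambda>\<omega>. a * U \<omega> + b * V \<omega> + c * W \<omega>)
    (sqrt ((a * u)\<^sup>2 + (b * v)\<^sup>2 + (c * w)\<^sup>2))"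
begin

lemma measurable_uvw [measurable]:
  "U \<in> borel_measurable M" "V \<in> borel_measurable M" "W \<in> borel_measurable M"
  using lin[of 1 0 0] lin[of 0 1 0] lin[of 0 0 1] by (simp_all add: has_gauss_moments_def)

lemma integrable_uvw:
  "integrable M (\<lambda>\<omega>. U \<omega> ^ i * (V \<omega> ^ j * W \<omega> ^ k))"
proof -
  have "integrable M (\<lambda>\<omega>. U \<omega> ^ n)" "integrable M (\<lambda>\<omega>. V \<omega> ^ n)" "integrable M (\<lambda>\<omega>. W \<omega> ^ n)" for n
    using lin[of 1 0 0, THEN has_gauss_moments_integrable] lin[of 0 1 0, THEN has_gauss_moments_integrable]
      lin[of 0 0 1, THEN has_gauss_moments_integrable] by simp_all
  moreover from this have "integrable M (\<lambda>\<omega>. V \<omega> ^ (2 * j) * W \<omega> ^ (2 * k))"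
    by (intro integrable_mult_square_integrable) (simp_all flip: power_mult)
  ultimately show ?thesis
    by (intro integrable_mult_square_integrable)
      (simp_all add: power_mult_distrib mult.commute[of _ 2] flip: power_mult)
qed

text \<open>Mixed moments factor by comparing coefficients twice: first of powers of
  \<open>U\<close> against combinations of \<open>V\<close> and \<open>W\<close>, then of
  \<open>V\<close> against \<open>W\<close> with a power of \<open>U\<close> as weight.\<close>

lemma integral_uvw:
  "(\<integral>\<omega>. U \<omega> ^ i * (V \<omega> ^ j * W \<omega> ^ k) \<partial>M) =
     (gauss_moment i * u ^ i) * ((gauss_moment j * v ^ j) * (gauss_moment k * w ^ k))"
proof -
  have 1: "(\<integral>\<omega>. U \<omega> ^ i * (b * V \<omega> + c * W \<omega>) ^ l \<partial>M) =
      (gauss_moment i * u ^ i) * (gauss_moment l * sqrt ((b * v)\<^sup>2 + (c * w)\<^sup>2) ^ l)" for b c l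
  proof -
    let ?T = "\<lambda>\<omega>. b * V \<omega> + c * W \<omega>" and ?r = "sqrt ((b * v)\<^sup>2 + (c * w)\<^sup>2)"
    \<comment> \<open>The exponent \<open>i + l - i\<close> has the shape N - k that coefficient
      comparison expects, with N = i + l.\<close>
    have "(\<integral>\<omega>. 1 * (U \<omega> ^ i * ?T \<omega> ^ (i + l - i)) \<partial>M) =
      (gauss_moment i * u ^ i) * (gauss_moment (i + l - i) * ?r ^ (i + l - i))"
    proof (rule integral_polynomial_coeff[where k = i and N = "i + l" and d =
        "\<lambda>k. (gauss_moment k * u ^ k) * (gauss_moment (i + l - k) * ?r ^ (i + l - k))"])
      fix k
      have "integrable M (\<lambda>\<omega>. U \<omega> ^ n)" "integrable M (\<lambda>\<omega>. ?T \<omega> ^ n)" for n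
        using lin[of 1 0 0, THEN has_gauss_moments_integrable] lin[of 0 b c, THEN has_gauss_moments_integrable]
        by simp_all
      then show "integrable M (\<lambda>\<omega>. 1 * (U \<omega> ^ k * ?T \<omega> ^ (i + l - k)))"
        unfolding mult_1 by (intro integrable_mult_square_integrable) (simp_all flip: power_mult)
    next
      fix t
      have "(\<integral>\<omega>. 1 * (t * U \<omega> + ?T \<omega>) ^ (i + l) \<partial>M) =
         gauss_moment (i + l) * sqrt ((t * u)\<^sup>2 + (b * v)\<^sup>2 + (c * w)\<^sup>2) ^ (i + l)"
        using lin[of t b c, THEN has_gauss_moments_integral] by (simp add: add.assoc)
      also have "\<dots> = (\<Sum>k\<le>i + l. real (i + l choose k) * (gauss_moment k * (t * u) ^ k) *
          (gauss_moment (i + l - k) * ?r ^ (i + l - k)))"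
        by (rule gauss_moment_binomial) simp
      finally show "(\<integral>\<omega>. 1 * (t * U \<omega> + ?T \<omega>) ^ (i + l) \<partial>M) = (\<Sum>k\<le>i + l. real (i + l choose k) *
          ((gauss_moment k * u ^ k) * (gauss_moment (i + l - k) * ?r ^ (i + l - k))) * t ^ k)"
        by (simp add: power_mult_distrib mult_ac)
    qed simp
    then show ?thesis by simp
  qed
  have "(\<integral>\<omega>. U \<omega> ^ i * (V \<omega> ^ j * W \<omega> ^ (j + k - j)) \<partial>M) =
     (gauss_moment i * u ^ i) * ((gauss_moment j * v ^ j) * (gauss_moment (j + k - j) * w ^ (j + k - j)))"
  proof (rule integral_polynomial_coeff[where k = j and N = "j + k" and d = "\<lambda>l. (gauss_moment i * u ^ i) *
      ((gauss_moment l * v ^ l) * (gauss_moment (j + k - l) * w ^ (j + k - l)))"])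
    fix t
    have "(\<integral>\<omega>. U \<omega> ^ i * (t * V \<omega> + W \<omega>) ^ (j + k) \<partial>M) =
       (gauss_moment i * u ^ i) * (gauss_moment (j + k) * sqrt ((t * v)\<^sup>2 + w\<^sup>2) ^ (j + k))"
      using 1[of t 1] by simp
    also have "gauss_moment (j + k) * sqrt ((t * v)\<^sup>2 + w\<^sup>2) ^ (j + k) =
       (\<Sum>l\<le>j + k. real (j + k choose l) * (gauss_moment l * (t * v) ^ l) *
          (gauss_moment (j + k - l) * w ^ (j + k - l)))"
      by (rule gauss_moment_binomial) simp
    finally show "(\<integral>\<omega>. U \<omega> ^ i * (t * V \<omega> + W \<omega>) ^ (j + k) \<partial>M) = (\<Sum>l\<le>j + k. real (j + k choose l) *
       ((gauss_moment i * u ^ i) * ((gauss_moment l * v ^ l) *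
          (gauss_moment (j + k - l) * w ^ (j + k - l)))) * t ^ l)"
      by (simp add: power_mult_distrib sum_distrib_left mult_ac)
  qed (simp_all add: integrable_uvw)
  then show ?thesis by simp
qed

section \<open>Moments weighted by powers of U^2 - V^2\<close>

lemma integral_weighted_monomial:
  "(\<integral>\<omega>. ((U \<omega>)\<^sup>2 - (V \<omega>)\<^sup>2) ^ m * (U \<omega> ^ i * (V \<omega> ^ j * W \<omega> ^ k)) \<partial>M) =
     (\<Sum>l\<le>m. real (m choose l) * (- 1) ^ (m - l) *
        (\<integral>\<omega>. U \<omega> ^ (2 * l + i) * (V \<omega> ^ (2 * (m - l) + j) * W \<omega> ^ k) \<partial>M))" (is ?eq)
  and integrable_weighted_monomial:
  "integrable M (\<lambda>\<omega>. ((U \<omega>)\<^sup>2 - (V \<omega>)\<^sup>2) ^ m * (U \<omega> ^ i * (V \<omega> ^ j * W \<omega> ^ k)))" (is ?int)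
proof -
  have "((x\<^sup>2 - y\<^sup>2) ^ m) * (x ^ i * (y ^ j * z ^ k)) =
     (\<Sum>l\<le>m. real (m choose l) * (- 1) ^ (m - l) * (x ^ (2 * l + i) * (y ^ (2 * (m - l) + j) * z ^ k)))"
    for x y z :: real
  proof -
    have "(x\<^sup>2 - y\<^sup>2) ^ m = (x\<^sup>2 + (- 1) * y\<^sup>2) ^ m" by simp
    also have "\<dots> = (\<Sum>l\<le>m. real (m choose l) * (- 1) ^ (m - l) * (x ^ (2 * l) * y ^ (2 * (m - l))))"
      by (simp only: binomial_ring power_mult_distrib power_mult[of _ 2]) (simp only: mult_ac)
    finally show ?thesis
      by (simp only: sum_distrib_right power_add) (simp only: mult_ac)
  qed
  then have *: "(\<lambda>\<omega>. ((U \<omega>)\<^sup>2 - (V \<omega>)\<^sup>2) ^ m * (U \<omega> ^ i * (V \<omega> ^ j * W \<omega> ^ k))) =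
     (\<lambda>\<omega>. \<Sum>l\<le>m. real (m choose l) * (- 1) ^ (m - l) *
        (U \<omega> ^ (2 * l + i) * (V \<omega> ^ (2 * (m - l) + j) * W \<omega> ^ k)))"
    by presburger
  show ?int unfolding * by (intro Bochner_Integration.integrable_sum integrable_mult_right integrable_uvw)
  show ?eq unfolding *
    by (subst Bochner_Integration.integral_sum)
      (simp_all only: integrable_mult_right integrable_uvw integral_mult_right_zero)
qed

text \<open>If some exponent is odd, both sides vanish. Otherwise p^i q^j and the plain moment are
  nonnegative, and the weight multiplies that moment by a constant times
  \<open>rising_coeff\<close>. The signs of \<open>p\<close> and \<open>q\<close> thus never
  matter.\<close>

lemma weighted_monomial_lower_bound:
  assumes "u\<^sup>2 + v\<^sup>2 = 1"
  shows "p ^ i * q ^ j * ((gauss_moment (2 * m))\<^sup>2 * (\<integral>\<omega>. U \<omega> ^ i * (V \<omega> ^ j * W \<omega> ^ k) \<partial>M)) \<le>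
    p ^ i * q ^ j * (\<integral>\<omega>. ((U \<omega>)\<^sup>2 - (V \<omega>)\<^sup>2) ^ (2 * m) * (U \<omega> ^ i * (V \<omega> ^ j * W \<omega> ^ k)) \<partial>M)"
proof (cases "even i \<and> even j \<and> even k")
  case False
  then show ?thesis
    unfolding integral_weighted_monomial integral_uvw
    by (auto simp: gauss_moment_odd)
next
  case True
  then obtain i' j' k' where ij: "i = 2 * i'" "j = 2 * j'" and k: "k = 2 * k'"
    by (elim conjE evenE)
  let ?a = "1 / 2 + real i'" and ?b = "1 / 2 + real j'"
  let ?E = "\<integral>\<omega>. U \<omega> ^ i * (V \<omega> ^ j * W \<omega> ^ k) \<partial>M"
  have E: "0 \<le> ?E"
    unfolding integral_uvw ij k by (intro mult_nonneg_nonneg gauss_moment_nonneg zero_le_even_power) auto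
  \<comment> \<open>Each term becomes one term of the Cauchy product in \<open>rising_coeff\<close>:
    the sign and the power of v^2 combine to a power of u^2 - 1, the powers of 2 to 4^m, and the
    binomial coefficient supplies the factorials.\<close>
  have summand: "real (2 * m choose l) * (- 1) ^ (2 * m - l) *
        (\<integral>\<omega>. U \<omega> ^ (2 * l + i) * (V \<omega> ^ (2 * (2 * m - l) + j) * W \<omega> ^ k) \<partial>M) =
      ?E * (4 ^ m * fact (2 * m) *
        ((pochhammer ?a l * (u\<^sup>2) ^ l / fact l) *
         (pochhammer ?b (2 * m - l) * (u\<^sup>2 - 1) ^ (2 * m - l) / fact (2 * m - l))))"
    if "l \<le> 2 * m" for l
  proof -
    have g: "gauss_moment (2 * l + i) = gauss_moment i * (2 ^ l * pochhammer ?a l)"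
      "gauss_moment (2 * (2 * m - l) + j) = gauss_moment j * (2 ^ (2 * m - l) * pochhammer ?b (2 * m - l))"
      using gauss_moment_add[of i' l] gauss_moment_add[of j' "2 * m - l"]
      unfolding ij by (simp_all only: add.commute distrib_left)
    have p2: "(4::real) ^ m = 2 ^ l * 2 ^ (2 * m - l)"
      using that by (simp add: power_mult flip: power_add)
    have v: "(u\<^sup>2 - 1) ^ n = (- 1) ^ n * v ^ (2 * n)" for n
    proof -
      have "u\<^sup>2 - 1 = (- 1) * v\<^sup>2" using assms by simp
      then show ?thesis by (simp only: power_mult_distrib power_mult)
    qed
    have c: "real (2 * m choose l) = fact (2 * m) / (fact l * fact (2 * m - l))"
      using that by (rule binomial_fact)
    show ?thesis
      unfolding integral_uvw g p2 v c power_add[of u] power_add[of v] power_mult[symmetric] by simp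
  qed
  have eq: "(\<integral>\<omega>. ((U \<omega>)\<^sup>2 - (V \<omega>)\<^sup>2) ^ (2 * m) * (U \<omega> ^ i * (V \<omega> ^ j * W \<omega> ^ k)) \<partial>M) =
      ?E * (4 ^ m * fact (2 * m) * rising_coeff ?a ?b (2 * m) (u\<^sup>2))"
    unfolding integral_weighted_monomial rising_coeff_def fps_mult_nth sum_distrib_left
      atLeast0AtMost
    by (rule sum.cong) (simp_all only: summand rising_fps_def fps_nth_Abs_fps atMost_iff)
  have bound: "(gauss_moment (2 * m))\<^sup>2 \<le> 4 ^ m * fact (2 * m) * rising_coeff ?a ?b (2 * m) (u\<^sup>2)"
  proof -
    \<comment> \<open>Writing one factor by factorials and the other by \<open>pochhammer\<close>
      exposes the lower bound for \<open>h = 1 / 2\<close>.\<close>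
    have "(gauss_moment (2 * m))\<^sup>2 = 4 ^ m * fact (2 * m) * (pochhammer (1 / 2) m / (4 ^ m * fact m))"
      unfolding power2_eq_square by (subst gauss_moment_fact, subst gauss_moment_even) simp
    also have "\<dots> \<le> 4 ^ m * fact (2 * m) * rising_coeff ?a ?b (2 * m) (u\<^sup>2)"
    proof (intro mult_left_mono rising_coeff_lower_bound)
      show "u\<^sup>2 \<le> 1" using assms zero_le_power2[of v] by linarith
    qed simp_all
    finally show ?thesis .
  qed
  have "0 \<le> p ^ i * q ^ j" by (simp add: ij)
  then show ?thesis
    unfolding eq mult.commute[of _ ?E] using E bound by (intro mult_left_mono)
qed

text \<open>Expanding the power into monomials gives nonnegative multinomial coefficients, so the
  monomial bound may be summed term by term.\<close>

lemma weighted_power_lower_bound: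
  assumes "u\<^sup>2 + v\<^sup>2 = 1"
  shows "(gauss_moment (2 * m))\<^sup>2 * (\<integral>\<omega>. (p * U \<omega> + q * V \<omega> + W \<omega>) ^ N \<partial>M) \<le>
    (\<integral>\<omega>. ((U \<omega>)\<^sup>2 - (V \<omega>)\<^sup>2) ^ (2 * m) * (p * U \<omega> + q * V \<omega> + W \<omega>) ^ N \<partial>M)"
proof -
  have expand: "(\<integral>\<omega>. ((U \<omega>)\<^sup>2 - (V \<omega>)\<^sup>2) ^ r * (p * U \<omega> + q * V \<omega> + W \<omega>) ^ N \<partial>M) =
     (\<Sum>i\<le>N. \<Sum>j\<le>N - i. real (N choose i) * real (N - i choose j) * (p ^ i * q ^ j *
       (\<integral>\<omega>. ((U \<omega>)\<^sup>2 - (V \<omega>)\<^sup>2) ^ r * (U \<omega> ^ i * (V \<omega> ^ j * W \<omega> ^ (N - i - j))) \<partial>M)))" for r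
  proof -
    have "s * (p * x + q * y + z) ^ N =
       (\<Sum>i\<le>N. \<Sum>j\<le>N - i. real (N choose i) * real (N - i choose j) * (p ^ i * q ^ j *
       (s * (x ^ i * (y ^ j * z ^ (N - i - j))))))" for s x y z :: real
      unfolding add.assoc binomial_ring[of "p * x"] binomial_ring[of "q * y"]
      by (simp only: sum_distrib_left sum_distrib_right power_mult_distrib mult_ac)
    then show ?thesis
      by (simp add: integrable_weighted_monomial)
  qed
  show ?thesis
    \<comment> \<open>The exponent 0 removes the weight, so the same expansion serves both
      sides.\<close>
    using expand[of 0] unfolding expand[of "2 * m"]
    by (simp only: power_0 mult_1 sum_distrib_left)
      (intro sum_mono, use weighted_monomial_lower_bound[OF assms] in
        \<open>simp only: mult.left_commute[of "(gauss_moment (2 * m))\<^sup>2"] mult.assoc mult_left_mono of_nat_0_le_iff\<close>)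
qed

end

section \<open>Splitting off the uncorrelated residual\<close>

lemma integral_square_linear_combination:
  fixes U V W :: "'w \<Rightarrow> real"
  assumes "U \<in> borel_measurable M" "V \<in> borel_measurable M" "W \<in> borel_measurable M"
    "integrable M (\<lambda>\<omega>. (U \<omega>)\<^sup>2)" "integrable M (\<lambda>\<omega>. (V \<omega>)\<^sup>2)" "integrable M (\<lambda>\<omega>. (W \<omega>)\<^sup>2)"
  shows "(\<integral>\<omega>. (a * U \<omega> + b * V \<omega> + c * W \<omega>)\<^sup>2 \<partial>M) =
    a\<^sup>2 * (\<integral>\<omega>. (U \<omega>)\<^sup>2 \<partial>M) + b\<^sup>2 * (\<integral>\<omega>. (V \<omega>)\<^sup>2 \<partial>M) + c\<^sup>2 * (\<integral>\<omega>. (W \<omega>)\<^sup>2 \<partial>M) +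
    2 * a * b * (\<integral>\<omega>. U \<omega> * V \<omega> \<partial>M) + 2 * a * c * (\<integral>\<omega>. U \<omega> * W \<omega> \<partial>M) + 2 * b * c * (\<integral>\<omega>. V \<omega> * W \<omega> \<partial>M)"
proof -
  have "(a * U \<omega> + b * V \<omega> + c * W \<omega>)\<^sup>2 = a\<^sup>2 * (U \<omega>)\<^sup>2 + b\<^sup>2 * (V \<omega>)\<^sup>2 + c\<^sup>2 * (W \<omega>)\<^sup>2 +
    2 * a * b * (U \<omega> * V \<omega>) + 2 * a * c * (U \<omega> * W \<omega>) + 2 * b * c * (V \<omega> * W \<omega>)" for \<omega>
    by (simp add: power2_eq_square algebra_simps)
  moreover have "integrable M (\<lambda>\<omega>. U \<omega> * V \<omega>)" "integrable M (\<lambda>\<omega>. U \<omega> * W \<omega>)" "integrable M (\<lambda>\<omega>. V \<omega> * W \<omega>)"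
    using assms by (auto intro: integrable_mult_square_integrable)
  ultimately show ?thesis using assms by simp
qed

text \<open>Linear regression of \<open>Z\<close> on \<open>U\<close> and \<open>V\<close>. As these
  are uncorrelated, \<open>p\<close> and \<open>q\<close> can be chosen separately; afterwards all
  cross terms vanish and second moments add.\<close>

lemma uncorrelated_gauss_residual:
  fixes U V Z :: "'w \<Rightarrow> real"
  assumes lin: "\<And>a b c. has_gauss_moments M (\<lambda>\<omega>. a * U \<omega> + b * V \<omega> + c * Z \<omega>)
      (sqrt (\<integral>\<omega>. (a * U \<omega> + b * V \<omega> + c * Z \<omega>)\<^sup>2 \<partial>M))"
    and UV: "(\<integral>\<omega>. U \<omega> * V \<omega> \<partial>M) = 0"
  obtains p q w where "uncorrelated_gauss M U V (\<lambda>\<omega>. Z \<omega> - p * U \<omega> - q * V \<omega>)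
      (sqrt (\<integral>\<omega>. (U \<omega>)\<^sup>2 \<partial>M)) (sqrt (\<integral>\<omega>. (V \<omega>)\<^sup>2 \<partial>M)) w"
proof -
  have [measurable]: "U \<in> borel_measurable M" "V \<in> borel_measurable M" "Z \<in> borel_measurable M"
    using lin[of 1 0 0] lin[of 0 1 0] lin[of 0 0 1] by (simp_all add: has_gauss_moments_def)
  have sq: "integrable M (\<lambda>\<omega>. (a * U \<omega> + b * V \<omega> + c * Z \<omega>)\<^sup>2)" for a b c
    using lin[of a b c] by (rule has_gauss_moments_integrable)
  have sq3: "integrable M (\<lambda>\<omega>. (U \<omega>)\<^sup>2)" "integrable M (\<lambda>\<omega>. (V \<omega>)\<^sup>2)" "integrable M (\<lambda>\<omega>. (Z \<omega>)\<^sup>2)"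
    using sq[of 1 0 0] sq[of 0 1 0] sq[of 0 0 1] by simp_all
  \<comment> \<open>If the second moment of \<open>S\<close> is zero, then \<open>S\<close> vanishes
    almost everywhere and so does the covariance; any p works.\<close>
  have proj: "\<exists>p. (\<integral>\<omega>. S \<omega> * Z \<omega> \<partial>M) = p * (\<integral>\<omega>. (S \<omega>)\<^sup>2 \<partial>M)"
    if [measurable]: "S \<in> borel_measurable M" and "integrable M (\<lambda>\<omega>. (S \<omega>)\<^sup>2)" for S
  proof (cases "(\<integral>\<omega>. (S \<omega>)\<^sup>2 \<partial>M) = 0")
    case True
    then have "AE \<omega> in M. (S \<omega>)\<^sup>2 = 0"
      using that by (subst (asm) integral_nonneg_eq_0_iff_AE) auto
    then have "(\<integral>\<omega>. S \<omega> * Z \<omega> \<partial>M) = (\<integral>\<omega>. 0 \<partial>M)"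
      by (intro integral_cong_AE) auto
    then show ?thesis by (simp add: True)
  next
    case False
    then show ?thesis
      by (intro exI[of _ "(\<integral>\<omega>. S \<omega> * Z \<omega> \<partial>M) / (\<integral>\<omega>. (S \<omega>)\<^sup>2 \<partial>M)"]) simp
  qed
  obtain p where p: "(\<integral>\<omega>. U \<omega> * Z \<omega> \<partial>M) = p * (\<integral>\<omega>. (U \<omega>)\<^sup>2 \<partial>M)"
    using proj[of U] sq3 by auto
  obtain q where q: "(\<integral>\<omega>. V \<omega> * Z \<omega> \<partial>M) = q * (\<integral>\<omega>. (V \<omega>)\<^sup>2 \<partial>M)"
    using proj[of V] sq3 by auto
  define W where "W = (\<lambda>\<omega>. Z \<omega> - p * U \<omega> - q * V \<omega>)"
  have [measurable]: "W \<in> borel_measurable M" by (simp add: W_def)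
  have W2: "integrable M (\<lambda>\<omega>. (W \<omega>)\<^sup>2)"
    using sq[of "- p" "- q" 1] by (simp add: W_def algebra_simps)
  have int: "integrable M (\<lambda>\<omega>. U \<omega> * V \<omega>)" "integrable M (\<lambda>\<omega>. U \<omega> * Z \<omega>)" "integrable M (\<lambda>\<omega>. V \<omega> * Z \<omega>)"
    using sq3 by (auto intro: integrable_mult_square_integrable)
  have "U \<omega> * W \<omega> = U \<omega> * Z \<omega> - p * (U \<omega>)\<^sup>2 - q * (U \<omega> * V \<omega>)"
    "V \<omega> * W \<omega> = V \<omega> * Z \<omega> - p * (U \<omega> * V \<omega>) - q * (V \<omega>)\<^sup>2" for \<omega>
    by (simp_all add: W_def power2_eq_square algebra_simps)
  then have UW: "(\<integral>\<omega>. U \<omega> * W \<omega> \<partial>M) = 0" "(\<integral>\<omega>. V \<omega> * W \<omega> \<partial>M) = 0"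
    using int sq3 p q UV by simp_all
  have "uncorrelated_gauss M U V W (sqrt (\<integral>\<omega>. (U \<omega>)\<^sup>2 \<partial>M)) (sqrt (\<integral>\<omega>. (V \<omega>)\<^sup>2 \<partial>M))
     (sqrt (\<integral>\<omega>. (W \<omega>)\<^sup>2 \<partial>M))"
  proof
    fix a b c
    have eq: "(\<lambda>\<omega>. a * U \<omega> + b * V \<omega> + c * W \<omega>) =
       (\<lambda>\<omega>. (a - c * p) * U \<omega> + (b - c * q) * V \<omega> + c * Z \<omega>)"
      by (simp add: W_def algebra_simps)
    have "(\<integral>\<omega>. (a * U \<omega> + b * V \<omega> + c * W \<omega>)\<^sup>2 \<partial>M) =
      a\<^sup>2 * (\<integral>\<omega>. (U \<omega>)\<^sup>2 \<partial>M) + b\<^sup>2 * (\<integral>\<omega>. (V \<omega>)\<^sup>2 \<partial>M) + c\<^sup>2 * (\<integral>\<omega>. (W \<omega>)\<^sup>2 \<partial>M)"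
      using sq3 W2 by (subst integral_square_linear_combination) (simp_all add: UV UW)
    moreover have "has_gauss_moments M (\<lambda>\<omega>. a * U \<omega> + b * V \<omega> + c * W \<omega>)
      (sqrt (\<integral>\<omega>. (a * U \<omega> + b * V \<omega> + c * W \<omega>)\<^sup>2 \<partial>M))"
      using lin[of "a - c * p" "b - c * q" c] unfolding eq[symmetric] fun_cong[OF eq, symmetric] .
    ultimately show "has_gauss_moments M (\<lambda>\<omega>. a * U \<omega> + b * V \<omega> + c * W \<omega>)
     (sqrt ((a * sqrt (\<integral>\<omega>. (U \<omega>)\<^sup>2 \<partial>M))\<^sup>2 + (b * sqrt (\<integral>\<omega>. (V \<omega>)\<^sup>2 \<partial>M))\<^sup>2 +
       (c * sqrt (\<integral>\<omega>. (W \<omega>)\<^sup>2 \<partial>M))\<^sup>2))"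
      by (simp add: power_mult_distrib)
  qed
  then show ?thesis unfolding W_def by (rule that)
qed

section \<open>Linear functionals of a centered Gaussian vector\<close>

lemma integrable_gaussian_rv:
  assumes "prob_space M" "gaussian_rv M T"
  shows "integrable M T"
proof -
  interpret prob_space M by fact
  have [measurable]: "T \<in> borel_measurable M" using assms by (simp add: gaussian_rv_def)
  show ?thesis
    using assms(2) unfolding gaussian_rv_def
  proof (elim conjE disjE exE)
    fix \<mu> \<sigma> :: real assume \<sigma>: "0 < \<sigma>" and D: "distributed M lborel T (normal_density \<mu> \<sigma>)"
    then show ?thesis
      using distributed_integrable[OF D, of "\<lambda>x. x"] integrable_normal_moment_nz_1[OF \<sigma>, of \<mu>] by simp
  next
    fix \<mu> assume "AE \<omega> in M. T \<omega> = \<mu>"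
    then show ?thesis by (subst integrable_cong_AE[of _ _ "\<lambda>_. \<mu>"]) auto
  qed
qed

lemma centered_gaussian_vector_inner:
  fixes V :: "'w \<Rightarrow> 'a::euclidean_space"
  assumes "prob_space M" "centered_gaussian_vector M V"
  shows "has_gauss_moments M (\<lambda>\<omega>. a \<bullet> V \<omega>) (sqrt (\<integral>\<omega>. (a \<bullet> V \<omega>)\<^sup>2 \<partial>M))"
proof -
  interpret prob_space M by fact
  have rv: "gaussian_rv M (\<lambda>\<omega>. b \<bullet> V \<omega>)" for b
    using assms(2) by (simp add: centered_gaussian_vector_def gaussian_vector_def)
  \<comment> \<open>Integrability of the vector itself, assembled from its components, is what lets
    the inner product pass through the integral.\<close>
  have "integrable M (\<lambda>\<omega>. \<Sum>b\<in>Basis. (b \<bullet> V \<omega>) *\<^sub>R b)"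
    using integrable_gaussian_rv[OF assms(1) rv] by auto
  moreover have "(\<Sum>b\<in>Basis. (b \<bullet> V \<omega>) *\<^sub>R b) = V \<omega>" for \<omega>
    by (subst inner_commute) (rule euclidean_representation)
  ultimately have "integrable M V" by simp
  then have "expectation (\<lambda>\<omega>. a \<bullet> V \<omega>) = 0"
    using assms(2) by (simp add: centered_gaussian_vector_def)
  then show ?thesis by (rule has_gauss_moments_centered[OF assms(1) rv])
qed

section \<open>Normalisation and the product inequality\<close>

theorem theorem3p2:
  fixes M :: "'w measure" and X Y Z :: "'w \<Rightarrow> real" and m n :: nat
  assumes "prob_space M"
    and "centered_gaussian_vector M (\<lambda>\<omega>. (X \<omega>, Y \<omega>, Z \<omega>))"
    and "0 < prob_space.variance M X"
    and "0 < prob_space.variance M Y"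
    and "0 < prob_space.variance M Z"
    and "1 \<le> m" and "1 \<le> n"
  shows "prob_space.expectation M (\<lambda>\<omega>. X \<omega> ^ (2 * m) * Y \<omega> ^ (2 * m) * Z \<omega> ^ (2 * n))
    \<ge> prob_space.expectation M (\<lambda>\<omega>. X \<omega> ^ (2 * m)) *
       prob_space.expectation M (\<lambda>\<omega>. Y \<omega> ^ (2 * m)) *
       prob_space.expectation M (\<lambda>\<omega>. Z \<omega> ^ (2 * n))"
proof -
  interpret prob_space M by fact
  have lin: "has_gauss_moments M (\<lambda>\<omega>. a * X \<omega> + b * Y \<omega> + c * Z \<omega>)
      (sqrt (expectation (\<lambda>\<omega>. (a * X \<omega> + b * Y \<omega> + c * Z \<omega>)\<^sup>2)))" for a b c
    using centered_gaussian_vector_inner[OF assms(1,2), of "(a, b, c)"] by (simp add: add.assoc)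
  define sx sy where "sx = sqrt (expectation (\<lambda>\<omega>. (X \<omega>)\<^sup>2))" and "sy = sqrt (expectation (\<lambda>\<omega>. (Y \<omega>)\<^sup>2))"
  have XY: "has_gauss_moments M X sx" "has_gauss_moments M Y sy"
    using lin[of 1 0 0] lin[of 0 1 0] by (simp_all add: sx_def sy_def)
  note [measurable] = XY[THEN has_gauss_moments_measurable]
  note int = XY[THEN has_gauss_moments_integrable]
  \<comment> \<open>Since the means vanish, the variances are the second moments, so the scales
    \<open>sx\<close> and \<open>sy\<close> are positive.\<close>
  have "expectation X = 0" "expectation Y = 0"
    using XY[THEN has_gauss_moments_integral, of 1] by (simp_all add: gauss_moment_def)
  then have pos: "0 < sx" "0 < sy"
    using assms(3,4) by (simp_all add: sx_def sy_def)
  have sq: "expectation (\<lambda>\<omega>. (X \<omega>)\<^sup>2) = sx\<^sup>2" "expectation (\<lambda>\<omega>. (Y \<omega>)\<^sup>2) = sy\<^sup>2"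
    by (simp_all add: sx_def sy_def)
  define U V where "U = (\<lambda>\<omega>. (X \<omega> / sx + Y \<omega> / sy) / 2)" and "V = (\<lambda>\<omega>. (X \<omega> / sx - Y \<omega> / sy) / 2)"
  have X: "X \<omega> = sx * (U \<omega> + V \<omega>)" and Y: "Y \<omega> = sy * (U \<omega> - V \<omega>)" for \<omega>
    using pos by (simp_all add: U_def V_def field_simps)
  \<comment> \<open>The product \<open>U * V\<close> is a quarter of the difference of the squares
    of the normalised variables, which have equal second moments.\<close>
  have UV: "expectation (\<lambda>\<omega>. U \<omega> * V \<omega>) = 0"
  proof -
    have "U \<omega> * V \<omega> = (X \<omega>)\<^sup>2 / (4 * sx\<^sup>2) - (Y \<omega>)\<^sup>2 / (4 * sy\<^sup>2)" for \<omega>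
      by (simp add: U_def V_def power2_eq_square algebra_simps diff_divide_distrib add_divide_distrib)
    then show ?thesis using int[of 2] sq pos by simp
  qed
  have "has_gauss_moments M (\<lambda>\<omega>. a * U \<omega> + b * V \<omega> + c * Z \<omega>)
      (sqrt (expectation (\<lambda>\<omega>. (a * U \<omega> + b * V \<omega> + c * Z \<omega>)\<^sup>2)))" for a b c
  proof -
    have "a * U \<omega> + b * V \<omega> + c * Z \<omega> = (a + b) / (2 * sx) * X \<omega> + (a - b) / (2 * sy) * Y \<omega> + c * Z \<omega>" for \<omega>
      by (simp add: U_def V_def algebra_simps diff_divide_distrib add_divide_distrib)
    then show ?thesis using lin[of "(a + b) / (2 * sx)" "(a - b) / (2 * sy)" c] by simp
  qed
  then obtain p q w where "uncorrelated_gauss M U V (\<lambda>\<omega>. Z \<omega> - p * U \<omega> - q * V \<omega>)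
      (sqrt (expectation (\<lambda>\<omega>. (U \<omega>)\<^sup>2))) (sqrt (expectation (\<lambda>\<omega>. (V \<omega>)\<^sup>2))) w"
    using UV by (rule uncorrelated_gauss_residual)
  then interpret uncorrelated_gauss M U V "\<lambda>\<omega>. Z \<omega> - p * U \<omega> - q * V \<omega>"
    "sqrt (expectation (\<lambda>\<omega>. (U \<omega>)\<^sup>2))" "sqrt (expectation (\<lambda>\<omega>. (V \<omega>)\<^sup>2))" w .
  have one: "expectation (\<lambda>\<omega>. (U \<omega>)\<^sup>2) + expectation (\<lambda>\<omega>. (V \<omega>)\<^sup>2) = 1"
  proof -
    have "integrable M (\<lambda>\<omega>. (U \<omega>)\<^sup>2)" "integrable M (\<lambda>\<omega>. (V \<omega>)\<^sup>2)"
      using integrable_uvw[of 2 0 0] integrable_uvw[of 0 2 0] by simp_all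
    then have "expectation (\<lambda>\<omega>. (U \<omega>)\<^sup>2) + expectation (\<lambda>\<omega>. (V \<omega>)\<^sup>2) =
        expectation (\<lambda>\<omega>. (U \<omega>)\<^sup>2 + (V \<omega>)\<^sup>2)" by simp
    also have "(\<lambda>\<omega>. (U \<omega>)\<^sup>2 + (V \<omega>)\<^sup>2) = (\<lambda>\<omega>. (X \<omega>)\<^sup>2 / (2 * sx\<^sup>2) + (Y \<omega>)\<^sup>2 / (2 * sy\<^sup>2))"
      by (simp add: U_def V_def power2_eq_square algebra_simps diff_divide_distrib add_divide_distrib)
    also have "expectation \<dots> = 1" using int[of 2] sq pos by simp
    finally show ?thesis .
  qed
  have prod: "X \<omega> ^ (2 * m) * Y \<omega> ^ (2 * m) * Z \<omega> ^ (2 * n) =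
      (sx ^ (2 * m) * sy ^ (2 * m)) * (((U \<omega>)\<^sup>2 - (V \<omega>)\<^sup>2) ^ (2 * m) * Z \<omega> ^ (2 * n))" for \<omega>
  proof -
    have "X \<omega> * Y \<omega> = sx * sy * ((U \<omega>)\<^sup>2 - (V \<omega>)\<^sup>2)"
      by (simp add: X Y power2_eq_square algebra_simps)
    then show ?thesis by (simp only: power_mult_distrib[symmetric] mult.assoc[symmetric])
  qed
  have "expectation (\<lambda>\<omega>. X \<omega> ^ (2 * m)) * expectation (\<lambda>\<omega>. Y \<omega> ^ (2 * m)) * expectation (\<lambda>\<omega>. Z \<omega> ^ (2 * n))
     = (sx ^ (2 * m) * sy ^ (2 * m)) * ((gauss_moment (2 * m))\<^sup>2 * expectation (\<lambda>\<omega>. Z \<omega> ^ (2 * n)))"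
    unfolding XY[THEN has_gauss_moments_integral] power2_eq_square by (simp only: mult_ac)
  also have "\<dots> \<le> (sx ^ (2 * m) * sy ^ (2 * m)) *
      expectation (\<lambda>\<omega>. ((U \<omega>)\<^sup>2 - (V \<omega>)\<^sup>2) ^ (2 * m) * Z \<omega> ^ (2 * n))"
    \<comment> \<open>Adding p U + q V to the residual gives back \<open>Z\<close>.\<close>
    using weighted_power_lower_bound[of m p q "2 * n"] one pos
    by (intro mult_left_mono) simp_all
  finally show ?thesis by (simp only: prod integral_mult_right_zero)
qed

end
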